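(* Let $\lambda>0$ and $p\in[0,1]$, let $N_+\sim\operatorname{Poisson}(\lambda p)$ and $N_-\sim\operatorname{Poisson}(\lambda(1-p))$ be independent, and let $X_{\lambda,p}=N_+-N_--\lambda(2p-1)$ (the centered Skellam law). Put $$p_-=\frac{2-\sqrt3}{4},\qquad p_+=\frac{2+\sqrt3}{4}.$$ The right scale is $$c_+(X_{\lambda,p})=\begin{cases}0,&p=0,\\ \max_{t>0}\Psi_p(t),&0<p<p_+,\\ \dfrac{2p-1}{3},&p_+\le p\le1.\end{cases}$$ For $0<p<p_+$ the maximum is attained at a positive finite argument and is strictly larger than $\max\{0,(2p-1)/3\}$. The left scale is $$c_-(X_{\lambda,p})=\begin{cases}\dfrac{1-2p}{3},&0\le p\le p_-,\\ \max_{t>0}\Psi_{1-p}(t),&p_-<p<1,\\ 0,&p=1,\end{cases}$$ and the middle regime $p_-<p<1$ is again interior controlled: the maximum is attained at a positive finite argument and is strictly larger than $\max\{0,(1-2p)/3\}$.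
   Context: For $p\in[0,1]$ and $t>0$ define $$M_p(t)=\frac{2}{t^2}\bigl\{\cosh t-1+(2p-1)(\sinh t-t)\bigr\},\qquad \Psi_p(t)=\frac{1-M_p(t)^{-1}}{t}.$$ The variance of $X_{\lambda,p}$ is $V=\lambda$. For a centered random variable $X$ with variance $V>0$ and $K_X(t)=\log\mathbb{E}e^{tX}$, $c_+(X)$ is the infimum of all $c\ge0$ such that $K_X(t)\le\frac{Vt^2}{2(1-ct)}$ for every $0\le t<1/c$ (with $1/0=\infty$ and $\inf\emptyset=\infty$), and $c_-(X)=c_+(-X)$. *)

theory Defs
  imports "HOL-Probability.Probability"
begin

(* The library's poisson_pmf is specified only for rate > 0; Poisson(0) is the
   point mass at 0. *)
definition poisson_law :: "real \<Rightarrow> nat pmf" where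
  "poisson_law r = (if r = 0 then return_pmf 0 else poisson_pmf r)"

lemma pmf_poisson_law:
  assumes "0 \<le> r"
  shows "pmf (poisson_law r) k = r ^ k / fact k * exp (- r)"
  using assms by (cases "k = 0") (auto simp: poisson_law_def)

(* Extended-real valued: K_X(t) is infinite when E exp(t X) is. *)
definition cgf :: "'a measure \<Rightarrow> ('a \<Rightarrow> real) \<Rightarrow> real \<Rightarrow> ereal" where
  "cgf M X t =
    (if integrable M (\<lambda>\<omega>. exp (t * X \<omega>))
     then ereal (ln (prob_space.expectation M (\<lambda>\<omega>. exp (t * X \<omega>))))
     else \<infinity>)"

(* Meant for centered X with positive variance. The disjunct c = 0 encodes 1/0 = \<infinity>;
   the infimum of the empty set in ereal is \<infinity>. *)
definition right_scale :: "'a measure \<Rightarrow> ('a \<Rightarrow> real) \<Rightarrow> ereal" where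
  "right_scale M X =
    Inf {ereal c | c. 0 \<le> c \<and>
      (\<forall>t. 0 \<le> t \<and> (c = 0 \<or> t < 1 / c) \<longrightarrow>
        cgf M X t \<le> ereal (prob_space.variance M X * t\<^sup>2 / (2 * (1 - c * t))))}"

definition left_scale :: "'a measure \<Rightarrow> ('a \<Rightarrow> real) \<Rightarrow> ereal" where
  "left_scale M X = right_scale M (\<lambda>\<omega>. - X \<omega>)"

definition skellam_M :: "real \<Rightarrow> real \<Rightarrow> real" where
  "skellam_M p t = 2 / t\<^sup>2 * (cosh t - 1 + (2 * p - 1) * (sinh t - t))"

definition skellam_Psi :: "real \<Rightarrow> real \<Rightarrow> real" where
  "skellam_Psi p t = (1 - inverse (skellam_M p t)) / t"

definition p_minus :: real where "p_minus = (2 - sqrt 3) / 4"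

definition p_plus :: real where "p_plus = (2 + sqrt 3) / 4"

end

theory Submission
  imports Defs "HOL-Real_Asymp.Real_Asymp"
begin

text \<open>
  Put \<open>q = 2 * p - 1\<close>. The cumulant generating function is \<open>rate * t\<^sup>2 / 2 * M\<^sub>p t\<close>, so \<open>c\<close> is admissible
  iff \<open>c \<ge> 0\<close> and \<open>\<Psi>\<^sub>p \<le> c\<close> on the positive half-line. There \<open>\<Psi>\<^sub>p\<close> tends to \<open>q / 3\<close> at \<open>0\<close> with slope
  \<open>1 / 12 - q\<^sup>2 / 9\<close>, which is positive exactly for \<open>p\<close> strictly between \<open>p_minus\<close> and \<open>p_plus\<close>, and
  \<open>\<Psi>\<^sub>p t < 1 / t\<close>. For \<open>0 < p < p_plus\<close> some value exceeds both end limits (near \<open>0\<close> if \<open>p \<ge> 1 / 2\<close>,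
  for large \<open>t\<close> if \<open>p < 1 / 2\<close>), hence the maximum is interior. For \<open>p \<ge> p_plus\<close>, \<open>\<Psi>\<^sub>p \<le> q / 3\<close> says
  that \<open>t\<^sup>2 / 2 - (1 - q * t / 3) * (cosh t - 1 + q * (sinh t - t))\<close> is nonnegative; it vanishes to
  third order at \<open>0\<close>, and its third derivative is nonnegative by \<open>sinh t \<le> t * cosh t\<close> and \<open>q\<^sup>2 \<ge> 3 / 4\<close>.
  The left scale follows by exchanging \<open>p\<close> and \<open>1 - p\<close>.
\<close>

section \<open>Taylor bounds for hyperbolic functions and the exponential\<close>

lemma nonneg_if_deriv_nonneg:
  fixes f f' :: "real \<Rightarrow> real"
  assumes "f 0 = 0" "\<And>t. (f has_real_derivative f' t) (at t)" "\<And>t. 0 \<le> t \<Longrightarrow> 0 \<le> f' t" "0 \<le> t"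
  shows "0 \<le> f t"
  using DERIV_nonneg_imp_nondecreasing[of 0 t f] assms by force

lemma sinh_le_mult_cosh:
  fixes t :: real
  assumes "0 \<le> t"
  shows "sinh t \<le> t * cosh t"
proof -
  have "0 \<le> t * cosh t - sinh t"
    by (rule nonneg_if_deriv_nonneg[where f = "\<lambda>t. t * cosh t - sinh t"
        and f' = "\<lambda>t. t * sinh t"])
      (use assms in \<open>auto intro!: derivative_eq_intros\<close>)
  then show ?thesis by simp
qed

text \<open>Integrate \<open>1 \<le> cosh t\<close> three times from 0. A fourth integration gives
  the quartic bound for \<open>cosh\<close>; together they bound \<open>skellam_M\<close> from below
  near 0.\<close>

lemma sinh_ge_cubic:
  fixes t :: real
  assumes "0 \<le> t"
  shows "t + t ^ 3 / 6 \<le> sinh t"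
proof -
  have 1: "0 \<le> sinh t - t" if "0 \<le> t" for t :: real
    by (rule nonneg_if_deriv_nonneg[where f = "\<lambda>t. sinh t - t"
        and f' = "\<lambda>t. cosh t - 1"])
      (use that in \<open>auto intro!: derivative_eq_intros simp: cosh_real_ge_1\<close>)
  have 2: "0 \<le> cosh t - 1 - t\<^sup>2 / 2" if "0 \<le> t" for t :: real
    by (rule nonneg_if_deriv_nonneg[where f = "\<lambda>t. cosh t - 1 - t\<^sup>2 / 2"
        and f' = "\<lambda>t. sinh t - t"])
      (use that 1 in \<open>auto intro!: derivative_eq_intros\<close>)
  have "0 \<le> sinh t - t - t ^ 3 / 6"
    by (rule nonneg_if_deriv_nonneg[where f = "\<lambda>t. sinh t - t - t ^ 3 / 6"
        and f' = "\<lambda>t. cosh t - 1 - t\<^sup>2 / 2"])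
      (use assms 2 in \<open>auto intro!: derivative_eq_intros\<close>)
  then show ?thesis by simp
qed

lemma cosh_ge_quartic:
  fixes t :: real
  assumes "0 \<le> t"
  shows "1 + t\<^sup>2 / 2 + t ^ 4 / 24 \<le> cosh t"
proof -
  have "0 \<le> cosh t - 1 - t\<^sup>2 / 2 - t ^ 4 / 24"
    by (rule nonneg_if_deriv_nonneg[where f = "\<lambda>t. cosh t - 1 - t\<^sup>2 / 2 - t ^ 4 / 24"
        and f' = "\<lambda>t. sinh t - t - t ^ 3 / 6"])
      (use assms sinh_ge_cubic in \<open>auto intro!: derivative_eq_intros simp: field_simps\<close>)
  then show ?thesis by simp
qed

lemma exp_minus_le_quadratic:
  fixes t :: real
  assumes "0 \<le> t"
  shows "exp (- t) \<le> 1 - t + t\<^sup>2 / 2"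
proof -
  have "0 \<le> 1 - t + t\<^sup>2 / 2 - exp (- t)"
    by (rule nonneg_if_deriv_nonneg[where f = "\<lambda>t. 1 - t + t\<^sup>2 / 2 - exp (- t)"
        and f' = "\<lambda>t. exp (- t) - 1 + t"])
      (use assms exp_ge_add_one_self[of "- t" for t :: real] in
        \<open>auto intro!: derivative_eq_intros simp: algebra_simps\<close>)
  then show ?thesis by simp
qed

section \<open>The threshold and basic properties of \<open>skellam_M\<close> and
  \<open>skellam_Psi\<close>\<close>

lemma p_plus_bounds: "1 / 2 < p_plus" "p_plus < 1"
proof -
  have "0 < sqrt (3::real)" "sqrt (3::real) < sqrt 4"
    by (simp_all only: real_sqrt_gt_0_iff real_sqrt_less_iff)
  then show "1 / 2 < p_plus" "p_plus < 1" by (simp_all add: p_plus_def)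
qed

text \<open>Separates the contributions of upward and downward jumps, which makes positivity and
  growth at infinity visible.\<close>

lemma skellam_M_eq_exp:
  "skellam_M p t = 2 / t\<^sup>2 * (p * (exp t - 1 - t) + (1 - p) * (exp (- t) - 1 + t))"
proof -
  have "cosh t - 1 + (2 * p - 1) * (sinh t - t)
      = p * (exp t - 1 - t) + (1 - p) * (exp (- t) - 1 + t)"
    unfolding cosh_field_def sinh_field_def by (simp add: field_simps)
  then show ?thesis by (simp only: skellam_M_def)
qed

lemma skellam_M_pos:
  assumes "0 \<le> p" "p \<le> 1" "0 < t"
  shows "0 < skellam_M p t"
proof -
  have pos: "0 < exp s - 1 - s" if "s \<noteq> 0" for s :: real
    using exp_minus_greater[of "- s"] that by simp
  have "0 < p * (exp t - 1 - t) + (1 - p) * (exp (- t) - 1 + t)"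
  \<comment> \<open>Strict positivity comes from the first summand if \<open>p > 0\<close>, and from
    the second if \<open>p = 0\<close>.\<close>
  proof (cases "p = 0")
    case False
    then show ?thesis
      using assms pos[of t] pos[of "- t"]
      by (intro add_pos_nonneg mult_pos_pos mult_nonneg_nonneg) auto
  qed (use assms pos[of "- t"] in simp)
  then show ?thesis
    using assms by (simp add: skellam_M_eq_exp)
qed

text \<open>Clear the positive factors \<open>t\<close> and \<open>skellam_M p t\<close>; the sign
  of \<open>1 - c * t\<close> does not matter.\<close>

lemma skellam_Psi_le_iff:
  assumes "0 \<le> p" "p \<le> 1" "0 < t"
  shows "skellam_Psi p t \<le> c \<longleftrightarrow> (1 - c * t) * skellam_M p t \<le> 1"
  using skellam_M_pos[OF assms] assms(3) by (auto simp: skellam_Psi_def field_simps)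

lemma skellam_Psi_less_inverse:
  assumes "0 \<le> p" "p \<le> 1" "0 < t"
  shows "skellam_Psi p t < 1 / t"
  using skellam_M_pos[OF assms] assms(3) by (auto simp: skellam_Psi_def field_simps)

lemma skellam_Psi_tendsto_0:
  "(skellam_Psi p \<longlongrightarrow> (2 * p - 1) / 3) (at_right 0)"
proof -
  have c: "((\<lambda>t::real. (cosh t - 1 - t\<^sup>2 / 2) / t ^ 3) \<longlongrightarrow> 0) (at_right 0)"
    unfolding cosh_field_def by real_asymp
  have s: "((\<lambda>t::real. (sinh t - t) / t ^ 3) \<longlongrightarrow> 1 / 6) (at_right 0)"
    unfolding sinh_field_def by real_asymp
  \<comment> \<open>\<open>r t\<close> is \<open>(skellam_M p t - 1) / t\<close>, so that
    \<open>skellam_Psi p t = r t / (1 + t * r t)\<close>, a quotient that is regular at 0.\<close>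
  define r where "r t = 2 * ((cosh t - 1 - t\<^sup>2 / 2) / t ^ 3 + (2 * p - 1) * ((sinh t - t) / t ^ 3))"
    for t :: real
  have "(r \<longlongrightarrow> 2 * (0 + (2 * p - 1) * (1 / 6))) (at_right 0)"
    unfolding r_def by (intro tendsto_intros c s)
  then have r: "(r \<longlongrightarrow> (2 * p - 1) / 3) (at_right 0)"
    by (rule back_subst[where P = "\<lambda>l. (r \<longlongrightarrow> l) _"]) simp
  have "((\<lambda>t. 1 + t * r t) \<longlongrightarrow> 1 + 0 * ((2 * p - 1) / 3)) (at_right 0)"
    by (intro tendsto_intros r)
  then have m: "((\<lambda>t. 1 + t * r t) \<longlongrightarrow> 1) (at_right 0)" by simp
  from tendsto_divide[OF r m]
  have "((\<lambda>t. r t / (1 + t * r t)) \<longlongrightarrow> (2 * p - 1) / 3) (at_right 0)" by simp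
  moreover have "\<forall>\<^sub>F t in at_right 0. r t / (1 + t * r t) = skellam_Psi p t"
    using eventually_at_right_less[of 0] order_tendstoD(1)[OF m, of 0, simplified]
  proof eventually_elim
    case (elim t)
    have M: "skellam_M p t = 1 + t * r t"
      using elim by (simp add: skellam_M_def r_def field_simps power2_eq_square power3_eq_cube)
    have "skellam_Psi p t = (1 - 1 / (1 + t * r t)) / t"
      by (simp add: skellam_Psi_def M inverse_eq_divide)
    also have "1 - 1 / (1 + t * r t) = t * r t / (1 + t * r t)"
      using elim by (simp add: diff_divide_eq_iff)
    finally show ?case using elim by simp
  qed
  ultimately show ?thesis by (rule Lim_transform_eventually)
qed

section \<open>The maximum of \<open>skellam_Psi\<close> and its size in each regime\<close>

lemma continuous_on_skellam_Psi:
  assumes "0 \<le> p" "p \<le> 1"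
  shows "continuous_on {0<..} (skellam_Psi p)"
proof -
  have "continuous_on {0<..} (skellam_M p)"
    unfolding skellam_M_def by (intro continuous_intros) auto
  then show ?thesis
    unfolding skellam_Psi_def using skellam_M_pos[OF assms]
    by (intro continuous_intros) (auto simp: less_le)
qed

text \<open>With \<open>v\<close> the value at \<open>s\<close>, \<open>skellam_Psi\<close> stays
  below \<open>v\<close> near 0 by the limit there, and beyond \<open>1 / v\<close> by the bound
  \<open>1 / t\<close>. Compactness of the interval between settles the rest.\<close>

lemma skellam_Psi_attains_max:
  assumes p: "0 \<le> p" "p \<le> 1" and s: "0 < s" "max 0 ((2 * p - 1) / 3) < skellam_Psi p s"
  obtains t where "0 < t" "\<And>u. 0 < u \<Longrightarrow> skellam_Psi p u \<le> skellam_Psi p t"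
    "max 0 ((2 * p - 1) / 3) < skellam_Psi p t"
proof -
  define v where "v = skellam_Psi p s"
  have v: "0 < v" "(2 * p - 1) / 3 < v" using s by (auto simp: v_def)
  from order_tendstoD(2)[OF skellam_Psi_tendsto_0 v(2)]
  obtain d where d: "0 < d" "\<And>u. 0 < u \<Longrightarrow> u < d \<Longrightarrow> skellam_Psi p u < v"
    by (auto simp: eventually_at_right_field)
  \<comment> \<open>The point \<open>s\<close> lies in the compact interval, so the interval is
    nonempty and the maximum on it is at least \<open>v\<close>.\<close>
  have s_mem: "s \<in> {d..1 / v}"
    using d(2)[of s] s(1) v(1) skellam_Psi_less_inverse[OF p s(1)]
    by (fastforce simp: v_def field_simps)
  have "continuous_on {d..1 / v} (skellam_Psi p)"
    using continuous_on_skellam_Psi[OF p] by (rule continuous_on_subset) (use d in auto)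
  then obtain t where t: "t \<in> {d..1 / v}" "\<forall>u\<in>{d..1 / v}. skellam_Psi p u \<le> skellam_Psi p t"
    using continuous_attains_sup[of "{d..1 / v}" "skellam_Psi p"] s_mem by auto
  then have vt: "v \<le> skellam_Psi p t" using s_mem by (auto simp: v_def)
  show thesis
  proof (rule that)
    fix u :: real assume u: "0 < u"
    consider "u < d" | "u \<in> {d..1 / v}" | "1 / v < u" by fastforce
    then show "skellam_Psi p u \<le> skellam_Psi p t"
    proof cases
      case 3
      then have "1 / u < v" using u v by (simp add: field_simps)
      then show ?thesis using skellam_Psi_less_inverse[OF p u] vt by simp
    qed (use t d(2)[OF u] vt in auto)
  qed (use t d v vt in auto)
qed

lemma skellam_Psi_le_of_p_plus_le:
  assumes p: "p_plus \<le> p" "p \<le> 1" and t: "0 < t"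
  shows "skellam_Psi p t \<le> (2 * p - 1) / 3"
proof -
  define q where "q = 2 * p - 1"
  have q0: "0 < q" using p p_plus_bounds by (simp add: q_def)
  have "sqrt 3 / 2 \<le> q" using p by (simp add: q_def p_plus_def)
  then have "(sqrt 3 / 2)\<^sup>2 \<le> q\<^sup>2" by (intro power_mono) auto
  then have q2: "3 / 4 \<le> q\<^sup>2" by (simp add: power_divide)
  \<comment> \<open>\<open>g\<close> is \<open>t ^ 2 / 2\<close> times
    \<open>1 - (1 - q / 3 * t) * skellam_M p t\<close>; \<open>g1\<close>, \<open>g2\<close>,
    \<open>g3\<close> are its successive derivatives. The slope \<open>q / 3\<close> makes the
    \<open>q * cosh t\<close> terms cancel in \<open>g3\<close>.\<close>
  define g3 where "g3 t = (q\<^sup>2 - 1) * sinh t + q / 3 * t * (sinh t + q * cosh t)" for t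
  define g2 where "g2 t = 1 + 2 * q / 3 * (sinh t + q * (cosh t - 1))
    - (1 - q / 3 * t) * (cosh t + q * sinh t)" for t
  define g1 where "g1 t = t + q / 3 * (cosh t - 1 + q * (sinh t - t))
    - (1 - q / 3 * t) * (sinh t + q * (cosh t - 1))" for t
  define g where "g t = t\<^sup>2 / 2 - (1 - q / 3 * t) * (cosh t - 1 + q * (sinh t - t))" for t
  \<comment> \<open>The chain needs \<open>1 - q ^ 2 \<le> 1 / 4 \<le> q ^ 2 / 3\<close>; both
    halves are \<open>q ^ 2 \<ge> 3 / 4\<close>, with equality exactly at
    \<open>p = p_plus\<close>.\<close>
  have g3: "0 \<le> g3 t" if t: "0 \<le> t" for t
  proof -
    have "(1 - q\<^sup>2) * sinh t \<le> 1 / 4 * sinh t"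
      using q2 t by (intro mult_right_mono) auto
    also have "\<dots> \<le> 1 / 4 * (t * cosh t)"
      using sinh_le_mult_cosh[OF t] by simp
    also have "\<dots> \<le> q\<^sup>2 / 3 * (t * cosh t)"
      using q2 t by (intro mult_right_mono) auto
    finally have "0 \<le> (q\<^sup>2 - 1) * sinh t + q\<^sup>2 / 3 * (t * cosh t)"
      by (simp add: algebra_simps)
    moreover have "0 \<le> q / 3 * t * sinh t" using q0 t by simp
    ultimately show ?thesis
      unfolding g3_def by (simp add: field_simps power2_eq_square)
  qed
  have d2: "(g2 has_real_derivative g3 t) (at t)" for t
    unfolding g2_def g3_def
    by (auto intro!: derivative_eq_intros simp: field_simps power2_eq_square)
  have d1: "(g1 has_real_derivative g2 t) (at t)" for t
    unfolding g1_def g2_def by (auto intro!: derivative_eq_intros simp: field_simps)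
  have d0: "(g has_real_derivative g1 t) (at t)" for t
    unfolding g_def g1_def by (auto intro!: derivative_eq_intros simp: field_simps)
  have "0 \<le> g2 t" if "0 \<le> t" for t
    by (rule nonneg_if_deriv_nonneg[OF _ d2 g3 that]) (simp_all add: g2_def)
  then have "0 \<le> g1 t" if "0 \<le> t" for t
    using that by (intro nonneg_if_deriv_nonneg[OF _ d1]) (simp_all add: g1_def)
  then have "0 \<le> g t"
    using t by (intro nonneg_if_deriv_nonneg[OF _ d0]) (simp_all add: g_def)
  then have "(1 - q / 3 * t) * skellam_M p t \<le> 1"
    using t unfolding g_def skellam_M_def q_def[symmetric] by (simp add: field_simps)
  moreover have "0 \<le> p" using q0 by (simp add: q_def)
  ultimately show ?thesis
    using skellam_Psi_le_iff[of p t "q / 3"] p t by (simp add: q_def)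
qed

lemma skellam_Psi_exceeds_limits:
  assumes p: "0 < p" "p < p_plus"
  obtains s where "0 < s" "max 0 ((2 * p - 1) / 3) < skellam_Psi p s"
proof (cases "p < 1 / 2")
  case True
  \<comment> \<open>Here \<open>2 * p - 1 < 0\<close>, so a positive value of
    \<open>skellam_Psi\<close>, that is \<open>skellam_M p t > 1\<close>, is enough. The term
    \<open>p * exp t\<close> forces this for large \<open>t\<close>.\<close>
  have "filterlim (skellam_M p) at_top at_top"
    unfolding skellam_M_eq_exp using p by real_asymp
  then have "\<forall>\<^sub>F t in at_top. 1 < skellam_M p t \<and> (0::real) < t"
    by (intro eventually_conj eventually_gt_at_top) (auto simp: filterlim_at_top_dense)
  then obtain t where "1 < skellam_M p t" "0 < t"
    by (auto dest: eventually_happens'[OF trivial_limit_at_top_linorder])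
  then have "0 < skellam_Psi p t"
    by (simp add: skellam_Psi_def field_simps)
  then show thesis using that[of t] \<open>0 < t\<close> True by simp
next
  case False
  define a where "a = (2 * p - 1) / 3"
  have p1: "p \<le> 1" using p p_plus_bounds by simp
  have a0: "0 \<le> a" using False by (simp add: a_def)
  have "a < sqrt 3 / 6" using p by (simp add: a_def p_plus_def)
  then have "a\<^sup>2 < (sqrt 3 / 6)\<^sup>2" using a0 by (intro power_strict_mono) auto
  then have a2: "0 < 1 / 12 - a\<^sup>2" by (simp add: power_divide)
  \<comment> \<open>The bound 1 keeps \<open>a * t \<le> 1 / 3\<close>, hence
    \<open>1 - a * t\<close> positive; the other bound makes \<open>a * t / 12 \<le> t / 36\<close>
    smaller than the gap \<open>1 / 12 - a ^ 2\<close>, which is positive because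
    \<open>p < p_plus\<close>.\<close>
  define t where "t = min 1 (1 / 12 - a\<^sup>2)"
  have t: "0 < t" using a2 by (simp add: t_def)
  have a1: "a \<le> 1/3" using p1 by (simp add: a_def)
  have at: "a * t \<le> 1 / 3" using mult_mono[OF a1, of t 1] a0 t by (simp add: t_def)
  have "a * t / 12 \<le> 1/36 * t" using mult_right_mono[OF a1, of t] t by simp
  also have "\<dots> < 1 / 12 - a\<^sup>2" using t a2 by (simp add: t_def min_def field_simps)
  finally have "0 < t\<^sup>2 * (1 / 12 - a\<^sup>2 - a * t / 12)" using t by simp
  then have "1 < (1 - a * t) * (1 + a * t + t\<^sup>2 / 12)"
    by (simp add: algebra_simps power2_eq_square)
  also have "\<dots> \<le> (1 - a * t) * skellam_M p t"
  \<comment> \<open>\<open>1 + a * t + t ^ 2 / 12\<close> is the second-order Taylor polynomial of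
    \<open>skellam_M p\<close> at 0. It is a lower bound since \<open>2 * p - 1 \<ge> 0\<close>
    preserves the direction of the \<open>sinh\<close> estimate.\<close>
  proof (rule mult_left_mono)
    have "t\<^sup>2 / 2 * (1 + a * t + t\<^sup>2 / 12) = t\<^sup>2 / 2 + t ^ 4 / 24 + (2 * p - 1) * (t ^ 3 / 6)"
      by (simp add: a_def field_simps power2_eq_square power3_eq_cube power4_eq_xxxx)
    also have "\<dots> \<le> cosh t - 1 + (2 * p - 1) * (sinh t - t)"
      using cosh_ge_quartic[of t] sinh_ge_cubic[of t] t False
      by (intro add_mono mult_left_mono) auto
    finally show "1 + a * t + t\<^sup>2 / 12 \<le> skellam_M p t"
      using t by (simp add: skellam_M_def field_simps)
  qed (use at in simp)
  finally have "a < skellam_Psi p t"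
    using skellam_Psi_le_iff[of p t a] p p1 t by auto
  then show thesis using that[of t] t a0 by (simp add: a_def)
qed

text \<open>Without upward jumps the bracket in \<open>skellam_M\<close> is
  \<open>exp (- t) - 1 + t\<close>, at most \<open>t ^ 2 / 2\<close>. Hence
  \<open>skellam_M 0 t \<le> 1\<close>, and the scale 0 is admissible.\<close>

lemma skellam_Psi_0_nonpos:
  assumes "0 < t"
  shows "skellam_Psi 0 t \<le> 0"
proof -
  have "cosh t - 1 - (sinh t - t) \<le> t\<^sup>2 / 2"
    using exp_minus_le_quadratic[of t] cosh_minus_sinh[of t] assms by simp
  then show ?thesis
    using assms by (simp add: skellam_Psi_le_iff skellam_M_def field_simps)
qed

section \<open>From the cumulant generating function to the right scale\<close>

text \<open>For \<open>c * t \<ge> 1\<close> the constraint \<open>\<Psi> t \<le> c\<close> holds anyway because \<open>\<Psi> t < 1 / t\<close>, so the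
  restriction \<open>t < 1 / c\<close> may be dropped.\<close>

lemma right_scale_eq_Inf_Psi:
  assumes p: "0 \<le> p" "p \<le> 1" and V: "0 < V" "prob_space.variance M X = V"
    and cgf: "\<And>t. cgf M X t = ereal (V * (cosh t - 1 + (2 * p - 1) * (sinh t - t)))"
  shows "right_scale M X = Inf {ereal c | c. 0 \<le> c \<and> (\<forall>t>0. skellam_Psi p t \<le> c)}"
proof -
  have iff: "cgf M X t \<le> ereal (V * t\<^sup>2 / (2 * (1 - c * t))) \<longleftrightarrow> skellam_Psi p t \<le> c"
    if "0 < t" "c * t < 1" for c t
  proof -
    have "cgf M X t = ereal (V * (t\<^sup>2 / 2 * skellam_M p t))"
      using that by (simp add: cgf skellam_M_def)
    moreover have "V * (t\<^sup>2 / 2 * skellam_M p t) \<le> V * t\<^sup>2 / (2 * (1 - c * t))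
        \<longleftrightarrow> V * t\<^sup>2 / 2 * ((1 - c * t) * skellam_M p t) \<le> V * t\<^sup>2 / 2 * 1"
      using that by (simp add: field_simps)
    ultimately show ?thesis
      unfolding skellam_Psi_le_iff[OF p that(1)] using that V
      by (simp only: ereal_less_eq) (subst mult_le_cancel_left_pos, simp_all)
  qed
  have "(\<forall>t. 0 \<le> t \<and> (c = 0 \<or> t < 1 / c) \<longrightarrow>
      cgf M X t \<le> ereal (V * t\<^sup>2 / (2 * (1 - c * t)))) \<longleftrightarrow> (\<forall>t>0. skellam_Psi p t \<le> c)"
    (is "?L \<longleftrightarrow> ?R") if c: "0 \<le> c" for c
  proof
    assume L: ?L
    show ?R
    proof (intro allI impI)
      fix t :: real assume t: "0 < t"
      show "skellam_Psi p t \<le> c"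
      proof (cases "c * t < 1")
        case True
        \<comment> \<open>The case \<open>c = 0\<close> is separate because \<open>1 / 0\<close>
          evaluates to 0 rather than infinity.\<close>
        moreover have "c = 0 \<or> t < 1 / c"
          using True c by (cases "c = 0") (simp_all add: field_simps)
        ultimately show ?thesis using L iff[OF t] t by (meson less_imp_le)
      next
        case False
        then have "1 / t \<le> c" using t by (simp add: field_simps)
        then show ?thesis using skellam_Psi_less_inverse[OF p t] by simp
      qed
    qed
  next
    assume R: ?R
    show ?L
    proof (intro allI impI)
      fix t :: real assume t: "0 \<le> t \<and> (c = 0 \<or> t < 1 / c)"
      show "cgf M X t \<le> ereal (V * t\<^sup>2 / (2 * (1 - c * t)))"
      \<comment> \<open>At \<open>t = 0\<close> both sides vanish.\<close>
      proof (cases "t = 0")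
        case False
        moreover have "c * t < 1" using t c by (cases "c = 0") (auto simp: field_simps)
        ultimately show ?thesis using iff R t by simp
      qed (simp add: cgf)
    qed
  qed
  then show ?thesis
    unfolding right_scale_def V(2) by (intro arg_cong[where f = Inf]) auto
qed

lemma right_scale_eq_if_least:
  assumes "right_scale M X = Inf {ereal c | c. 0 \<le> c \<and> P c}"
    and "0 \<le> c" "P c" "\<And>b. 0 \<le> b \<Longrightarrow> P b \<Longrightarrow> c \<le> b"
  shows "right_scale M X = ereal c"
  unfolding assms(1) by (rule Inf_eqI) (use assms(2-) in auto)

text \<open>Only the variance and the cumulant generating function enter, so the result applies to
  \<open>X\<close> and, with \<open>1 - p\<close> for \<open>p\<close>, to
  \<open>- X\<close>.\<close>

proposition right_scale_skellam:
  assumes p: "0 \<le> p" "p \<le> 1" and V: "0 < V" "prob_space.variance M X = V"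
    and cgf: "\<And>t. cgf M X t = ereal (V * (cosh t - 1 + (2 * p - 1) * (sinh t - t)))"
  shows "p = 0 \<Longrightarrow> right_scale M X = 0"
    and "0 < p \<Longrightarrow> p < p_plus \<Longrightarrow>
      \<exists>t0>0. (\<forall>t>0. skellam_Psi p t \<le> skellam_Psi p t0)
        \<and> right_scale M X = ereal (skellam_Psi p t0)
        \<and> max 0 ((2 * p - 1) / 3) < skellam_Psi p t0"
    and "p_plus \<le> p \<Longrightarrow> right_scale M X = ereal ((2 * p - 1) / 3)"
proof -
  note least = right_scale_eq_if_least[OF right_scale_eq_Inf_Psi[OF assms]]
  show "right_scale M X = 0" if "p = 0"
    using least[of 0] skellam_Psi_0_nonpos that by (simp add: zero_ereal_def)
  show "\<exists>t0>0. (\<forall>t>0. skellam_Psi p t \<le> skellam_Psi p t0)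
      \<and> right_scale M X = ereal (skellam_Psi p t0)
      \<and> max 0 ((2 * p - 1) / 3) < skellam_Psi p t0" if lt: "0 < p" "p < p_plus"
  proof -
    from skellam_Psi_exceeds_limits[OF lt] obtain s where
      s: "0 < s" "max 0 ((2 * p - 1) / 3) < skellam_Psi p s" .
    from skellam_Psi_attains_max[OF p s] obtain t where
      "0 < t" "\<And>u. 0 < u \<Longrightarrow> skellam_Psi p u \<le> skellam_Psi p t"
      "max 0 ((2 * p - 1) / 3) < skellam_Psi p t" by metis
    then show ?thesis using least[of "skellam_Psi p t"] by auto
  qed
  show "right_scale M X = ereal ((2 * p - 1) / 3)" if le: "p_plus \<le> p"
  proof (rule least)
    show "0 \<le> (2 * p - 1) / 3" using le p_plus_bounds by simp
    show "\<forall>t>0. skellam_Psi p t \<le> (2 * p - 1) / 3"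
      using skellam_Psi_le_of_p_plus_le le p by blast
    \<comment> \<open>Any upper bound of \<open>skellam_Psi p\<close> also bounds its limit at
      0.\<close>
    show "(2 * p - 1) / 3 \<le> b" if "\<forall>t>0. skellam_Psi p t \<le> b" for b
      using skellam_Psi_tendsto_0
      by (rule tendsto_upperbound)
        (use that eventually_at_right_less[of 0] in \<open>auto elim!: eventually_mono\<close>)
  qed
qed

section \<open>Poisson series, moments and independence\<close>

lemma has_bochner_integral_pmf_nat:
  fixes f :: "nat \<Rightarrow> real"
  assumes "(\<lambda>k. pmf D k * f k) sums s" "\<And>k. 0 \<le> f k"
  shows "has_bochner_integral (measure_pmf D) f s"
proof -
  have "integrable (count_space UNIV) (\<lambda>k. pmf D k * f k)"
    using assms by (simp add: integrable_count_space_nat_iff abs_mult sums_iff)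
  then have "has_bochner_integral (count_space UNIV) (\<lambda>k. pmf D k *\<^sub>R f k) s"
    using assms(1) by (simp add: has_bochner_integral_iff integral_count_space_nat sums_iff)
  then show ?thesis
    unfolding measure_pmf_eq_density by (intro has_bochner_integral_density) auto
qed

lemma poisson_law_exp_sums:
  assumes "0 \<le> r"
  shows "(\<lambda>k. pmf (poisson_law r) k * exp (t * real k)) sums exp (r * (exp t - 1))"
proof -
  have "(\<lambda>k. exp (- r) * ((r * exp t) ^ k /\<^sub>R fact k)) sums (exp (- r) * exp (r * exp t))"
    by (intro sums_mult exp_converges)
  moreover have "exp (- r) * ((r * exp t) ^ k /\<^sub>R fact k)
      = pmf (poisson_law r) k * exp (t * real k)" for k
    by (simp add: pmf_poisson_law[OF assms] power_mult_distrib exp_of_nat_mult[symmetric] field_simps)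
  ultimately show ?thesis
    by (simp add: exp_add[symmetric] algebra_simps)
qed

text \<open>The Chen-Stein identity \<open>E (N * f N) = r * E (f (N + 1))\<close>, from
  \<open>(k + 1) * pmf (k + 1) = r * pmf k\<close>.\<close>

lemma poisson_law_stein_sums:
  assumes r: "0 \<le> r" and s: "(\<lambda>k. pmf (poisson_law r) k * f (Suc k)) sums s"
  shows "(\<lambda>k. pmf (poisson_law r) k * (real k * f k)) sums (r * s)"
proof -
  have "pmf (poisson_law r) (Suc k) * (real (Suc k) * f (Suc k))
      = r * (pmf (poisson_law r) k * f (Suc k))" for k
    by (simp add: pmf_poisson_law[OF r] field_simps del: of_nat_Suc)
  with sums_mult[OF s, of r]
  have "(\<lambda>k. pmf (poisson_law r) (Suc k) * (real (Suc k) * f (Suc k))) sums (r * s)"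
    by (simp only:)
  \<comment> \<open>Undoing the index shift adds only the term at 0, which vanishes through the
    factor \<open>real k\<close>.\<close>
  then show ?thesis by (subst (asm) sums_Suc_iff) simp
qed

lemma
  assumes r: "0 \<le> r"
  shows poisson_law_mean_sums: "(\<lambda>k. pmf (poisson_law r) k * real k) sums r"
    and poisson_law_second_moment_sums: "(\<lambda>k. pmf (poisson_law r) k * (real k)\<^sup>2) sums (r\<^sup>2 + r)"
proof -
  have 0: "(\<lambda>k. pmf (poisson_law r) k) sums 1"
    using poisson_law_exp_sums[OF r, of 0] by simp
  show 1: "(\<lambda>k. pmf (poisson_law r) k * real k) sums r"
    using poisson_law_stein_sums[OF r, of "\<lambda>_. 1" 1] 0 by simp
  \<comment> \<open>The Stein identity with \<open>f k = k\<close> reduces the second moment to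
    \<open>r * E (N + 1)\<close>.\<close>
  have "(\<lambda>k. pmf (poisson_law r) k * real (Suc k)) sums (r + 1)"
    using sums_add[OF 1 0] by (simp add: algebra_simps)
  from poisson_law_stein_sums[OF r this]
  show "(\<lambda>k. pmf (poisson_law r) k * (real k)\<^sup>2) sums (r\<^sup>2 + r)"
    by (simp add: power2_eq_square algebra_simps)
qed

lemma has_bochner_integral_of_distr_pmf:
  fixes N :: "'a \<Rightarrow> nat" and f :: "nat \<Rightarrow> real"
  assumes "N \<in> M \<rightarrow>\<^sub>M count_space UNIV" "distr M (count_space UNIV) N = measure_pmf D"
    and "(\<lambda>k. pmf D k * f k) sums s" "\<And>k. 0 \<le> f k"
  shows "has_bochner_integral M (\<lambda>\<omega>. f (N \<omega>)) s"
proof -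
  have "has_bochner_integral (distr M (count_space UNIV) N) f s"
    using has_bochner_integral_pmf_nat[OF assms(3,4)] assms(2) by simp
  then show ?thesis
    using assms(1) by (simp add: has_bochner_integral_iff integrable_distr_eq integral_distr)
qed

lemma (in prob_space) has_bochner_integral_indep_mult:
  fixes f g :: "nat \<Rightarrow> real"
  assumes "indep_var (count_space UNIV) A (count_space UNIV) B"
    and "has_bochner_integral M (\<lambda>\<omega>. f (A \<omega>)) a" "has_bochner_integral M (\<lambda>\<omega>. g (B \<omega>)) b"
  shows "has_bochner_integral M (\<lambda>\<omega>. f (A \<omega>) * g (B \<omega>)) (a * b)"
proof -
  have "indep_var borel (\<lambda>\<omega>. f (A \<omega>)) borel (\<lambda>\<omega>. g (B \<omega>))"
    using indep_var_compose[OF assms(1), of f borel g borel] by (simp add: comp_def)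
  then show ?thesis
    using assms(2,3) by (simp add: has_bochner_integral_iff indep_var_integrable
        indep_var_lebesgue_integral)
qed

section \<open>The Skellam law and both of its scales\<close>

lemma (in prob_space) skellam_variance_cgf:
  fixes A B :: "'a \<Rightarrow> nat"
  assumes a: "0 \<le> a" and b: "0 \<le> b"
    and indep: "indep_var (count_space UNIV) A (count_space UNIV) B"
    and A: "distr M (count_space UNIV) A = measure_pmf (poisson_law a)"
    and B: "distr M (count_space UNIV) B = measure_pmf (poisson_law b)"
    and X: "X = (\<lambda>\<omega>. real (A \<omega>) - real (B \<omega>) - (a - b))"
  shows "variance X = a + b"
    and "cgf M X t = ereal (a * (exp t - 1 - t) + b * (exp (- t) - 1 + t))"
proof -
  note mA = has_bochner_integral_of_distr_pmf[OF indep_var_rv1[OF indep] A]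
  note mB = has_bochner_integral_of_distr_pmf[OF indep_var_rv2[OF indep] B]
  have A1: "has_bochner_integral M (\<lambda>\<omega>. real (A \<omega>)) a"
    by (rule mA[OF poisson_law_mean_sums[OF a]]) simp
  have B1: "has_bochner_integral M (\<lambda>\<omega>. real (B \<omega>)) b"
    by (rule mB[OF poisson_law_mean_sums[OF b]]) simp
  have A2: "has_bochner_integral M (\<lambda>\<omega>. (real (A \<omega>))\<^sup>2) (a\<^sup>2 + a)"
    by (rule mA[OF poisson_law_second_moment_sums[OF a]]) simp
  have B2: "has_bochner_integral M (\<lambda>\<omega>. (real (B \<omega>))\<^sup>2) (b\<^sup>2 + b)"
    by (rule mB[OF poisson_law_second_moment_sums[OF b]]) simp
  have c: "has_bochner_integral M (\<lambda>\<omega>. c) c" for c :: real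
    by (simp add: has_bochner_integral_iff prob_space)
  note AB = has_bochner_integral_indep_mult[OF indep A1 B1]
  define d where "d = a - b"
  have "has_bochner_integral M X (a - b - (a - b))"
    unfolding X by (intro has_bochner_integral_diff A1 B1 c)
  then have mean: "expectation X = 0" by (simp add: has_bochner_integral_iff)
  \<comment> \<open>Expansion of \<open>(A - B - d) ^ 2\<close> into terms with known integrals;
    independence supplies the mixed one.\<close>
  have "has_bochner_integral M
      (\<lambda>\<omega>. (real (A \<omega>))\<^sup>2 + (real (B \<omega>))\<^sup>2 + d\<^sup>2 - 2 * (real (A \<omega>) * real (B \<omega>))
         - 2 * d * real (A \<omega>) + 2 * d * real (B \<omega>))
      ((a\<^sup>2 + a) + (b\<^sup>2 + b) + d\<^sup>2 - 2 * (a * b) - 2 * d * a + 2 * d * b)"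
    by (intro has_bochner_integral_diff has_bochner_integral_add has_bochner_integral_mult_right
        A1 A2 B1 B2 AB c)
  also have "(\<lambda>\<omega>. (real (A \<omega>))\<^sup>2 + (real (B \<omega>))\<^sup>2 + d\<^sup>2 - 2 * (real (A \<omega>) * real (B \<omega>))
         - 2 * d * real (A \<omega>) + 2 * d * real (B \<omega>)) = (\<lambda>\<omega>. (X \<omega>)\<^sup>2)"
    by (simp add: X d_def power2_eq_square algebra_simps fun_eq_iff)
  also have "(a\<^sup>2 + a) + (b\<^sup>2 + b) + d\<^sup>2 - 2 * (a * b) - 2 * d * a + 2 * d * b = a + b"
    by (simp add: d_def power2_eq_square algebra_simps)
  finally show "variance X = a + b" by (simp add: mean has_bochner_integral_iff)

  \<comment> \<open>\<open>exp (t * X)\<close> splits into the centering constant and two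
    independent factors, whose means are Poisson moment generating functions at \<open>t\<close> and
    \<open>- t\<close>.\<close>
  have "has_bochner_integral M
      (\<lambda>\<omega>. exp (- t * d) * (exp (t * real (A \<omega>)) * exp (- t * real (B \<omega>))))
      (exp (- t * d) * (exp (a * (exp t - 1)) * exp (b * (exp (- t) - 1))))"
    by (intro has_bochner_integral_mult_right has_bochner_integral_indep_mult[OF indep]
        mA[OF poisson_law_exp_sums[OF a]] mB[OF poisson_law_exp_sums[OF b]]) auto
  also have "(\<lambda>\<omega>. exp (- t * d) * (exp (t * real (A \<omega>)) * exp (- t * real (B \<omega>))))
      = (\<lambda>\<omega>. exp (t * X \<omega>))"
    by (simp add: X d_def exp_add[symmetric] algebra_simps fun_eq_iff)
  also have "exp (- t * d) * (exp (a * (exp t - 1)) * exp (b * (exp (- t) - 1)))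
      = exp (a * (exp t - 1 - t) + b * (exp (- t) - 1 + t))"
    by (simp add: d_def exp_add[symmetric] algebra_simps)
  finally show "cgf M X t = ereal (a * (exp t - 1 - t) + b * (exp (- t) - 1 + t))"
    by (simp add: cgf_def has_bochner_integral_iff)
qed

theorem theorem6p2:
  fixes M :: "'a measure" and Np Nm :: "'a \<Rightarrow> nat" and X :: "'a \<Rightarrow> real"
    and rate p :: real
  assumes "prob_space M"
    and "0 < rate" and "0 \<le> p" and "p \<le> 1"
    and "prob_space.indep_var M (count_space UNIV) Np (count_space UNIV) Nm"
    and "distr M (count_space UNIV) Np = measure_pmf (poisson_law (rate * p))"
    and "distr M (count_space UNIV) Nm = measure_pmf (poisson_law (rate * (1 - p)))"
    and "X = (\<lambda>\<omega>. real (Np \<omega>) - real (Nm \<omega>) - rate * (2 * p - 1))"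
  shows "(p = 0 \<longrightarrow> right_scale M X = 0)
    \<and> (0 < p \<and> p < p_plus \<longrightarrow>
        (\<exists>t0>0. (\<forall>t>0. skellam_Psi p t \<le> skellam_Psi p t0)
          \<and> right_scale M X = ereal (skellam_Psi p t0)
          \<and> max 0 ((2 * p - 1) / 3) < skellam_Psi p t0))
    \<and> (p_plus \<le> p \<longrightarrow> right_scale M X = ereal ((2 * p - 1) / 3))
    \<and> (p \<le> p_minus \<longrightarrow> left_scale M X = ereal ((1 - 2 * p) / 3))
    \<and> (p_minus < p \<and> p < 1 \<longrightarrow>
        (\<exists>t0>0. (\<forall>t>0. skellam_Psi (1 - p) t \<le> skellam_Psi (1 - p) t0)
          \<and> left_scale M X = ereal (skellam_Psi (1 - p) t0)
          \<and> max 0 ((1 - 2 * p) / 3) < skellam_Psi (1 - p) t0))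
    \<and> (p = 1 \<longrightarrow> left_scale M X = 0)"
proof -
  interpret prob_space M by fact
  have rates: "0 \<le> rate * p" "0 \<le> rate * (1 - p)"
    using assms(2-4) by auto
  have X: "X = (\<lambda>\<omega>. real (Np \<omega>) - real (Nm \<omega>) - (rate * p - rate * (1 - p)))"
    unfolding assms(8) by (simp add: algebra_simps)
  note sk = skellam_variance_cgf[OF rates assms(5-7) X]
  have var: "variance X = rate"
    using sk(1) by (simp add: algebra_simps)
  have cgf: "cgf M X t = ereal (rate * (cosh t - 1 + (2 * p - 1) * (sinh t - t)))" for t
    unfolding sk(2) cosh_field_def sinh_field_def by (simp add: field_simps)
  have var': "variance (\<lambda>\<omega>. - X \<omega>) = rate"
    using var by (simp add: power2_commute)
  \<comment> \<open>Reflecting \<open>t\<close> fixes \<open>cosh\<close> and negates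
    \<open>sinh t - t\<close>, which amounts to replacing \<open>p\<close> by
    \<open>1 - p\<close>.\<close>
  have "cgf M (\<lambda>\<omega>. - X \<omega>) t = cgf M X (- t)" for t
    by (simp add: cgf_def)
  then have cgf': "cgf M (\<lambda>\<omega>. - X \<omega>) t
      = ereal (rate * (cosh t - 1 + (2 * (1 - p) - 1) * (sinh t - t)))" for t
    unfolding cgf by (simp add: algebra_simps)
  \<comment> \<open>Both equivalences rest on \<open>p_minus = 1 - p_plus\<close>.\<close>
  have reflect: "p \<le> p_minus \<longleftrightarrow> p_plus \<le> 1 - p" "p_minus < p \<longleftrightarrow> 1 - p < p_plus"
    by (auto simp: p_minus_def p_plus_def field_simps)
  have mean': "(2 * (1 - p) - 1) / 3 = (1 - 2 * p) / 3"
    by simp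
  have p': "0 \<le> 1 - p" "1 - p \<le> 1"
    using assms(3,4) by auto
  note R = right_scale_skellam[OF assms(3,4,2) var cgf]
  note L = right_scale_skellam[OF p' assms(2) var' cgf', folded left_scale_def, unfolded mean']
  show ?thesis
    unfolding reflect using R L by (intro conjI impI) auto
qed

end
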